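(* Let $w\ge 4$ be an even integer and $u=w-2$. Then $$\sum_{\substack{a+b+c=w\\ a\ge 2,\ b,c\ge1}}\big[(-1)^c-(-1)^a\big]\,\zeta(a,b,c)=\frac12\zeta(w)-\zeta(2)\zeta(u).$$
   Context: Multiple zeta values: for positive integers $s_1\ge2, s_2,\dots,s_d$, $\zeta(s_1,\dots,s_d)=\sum_{k_1>\cdots>k_d>0}k_1^{-s_1}\cdots k_d^{-s_d}$. *)

theory Defs
  imports "HOL-Analysis.Analysis"
begin

text \<open>
  The multiple zeta value of the exponent list \<open>s = [s\<^sub>1, \<dots>, s\<^sub>d]\<close>, with summation indices
  \<open>k\<^sub>1 > \<dots> > k\<^sub>d > 0\<close> (largest index first). The terms are nonnegative, so the unordered sum is the
  usual one; it is meaningful when all \<open>s\<^sub>i\<close> are positive and \<open>s\<^sub>1 \<ge> 2\<close>.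
\<close>
definition mzv :: "nat list \<Rightarrow> real" where
  "mzv s = (\<Sum>\<^sub>\<infinity>k\<in>{k :: nat list. length k = length s \<and> sorted_wrt (>) k \<and> (\<forall>n\<in>set k. 0 < n)}.
     \<Prod>i<length s. 1 / real (k ! i) ^ (s ! i))"

end

theory Submission
  imports Defs
begin

text \<open>
  Fix \<open>k > m > n\<close>. The signed sum of \<open>k^-a m^-b n^-c\<close> over all exponents of weight \<open>w\<close> is a sum of two
  complete homogeneous polynomials in \<open>1/k, \<plusminus>1/m, -1/n\<close>, so partial fractions turn it into a combination
  of \<open>k^-u\<close>, \<open>m^-u\<close> and \<open>n^-u\<close> with rational coefficients not depending on the weight. Summing over all
  triples and collecting, for each \<open>N\<close>, the triples with \<open>k = N\<close>, \<open>m = N\<close> or \<open>n = N\<close>, the total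
  coefficient of \<open>N^-u\<close> can be written through harmonic numbers and collapses to
  \<open>1/(2 N^2) - \<zeta>(2)\<close>. The rearrangement is done on the truncation \<open>k \<le> K\<close>, where the coefficient of
  \<open>N^-u\<close> is bounded by a multiple of \<open>sqrt N\<close> uniformly in \<open>K\<close>, and Tannery's theorem gives the limit.
\<close>

subsection \<open>Finite harmonic sums\<close>

definition harm2 :: "nat \<Rightarrow> real" where
  "harm2 n = (\<Sum>k=1..n. 1 / real k ^ 2)"

lemma harm2_0 [simp]: "harm2 0 = 0"
  by (simp add: harm2_def)

lemma harm2_Suc: "harm2 (Suc n) = harm2 n + 1 / real (Suc n) ^ 2"
  by (simp add: harm2_def)

lemma sum_shifted_inverse: "(\<Sum>j=1..n. 1 / (real m + real j)) = harm (m + n) - harm m"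
  by (induction n) (simp_all add: harm_Suc inverse_eq_divide)

lemma sum_greaterThanAtMost_inverse:
  assumes "m \<le> n"
  shows   "(\<Sum>k\<in>{m<..n}. 1 / real k) = harm n - harm m"
  using assms
proof (induction rule: dec_induct)
  case (step n)
  have "{m<..Suc n} = insert (Suc n) {m<..n}" using step by auto
  with step show ?case by (simp add: harm_Suc inverse_eq_divide)
qed simp

lemma sum_reflected_inverse:
  assumes "m < c"
  shows   "(\<Sum>i=1..m. 1 / (real c - real i)) = harm (c - 1) - harm (c - 1 - m)"
  using assms
proof (induction m)
  case (Suc m)
  obtain d where "c = Suc (Suc m) + d" using Suc.prems by (metis Suc_leI le_Suc_ex)
  with Suc show ?case by (simp add: harm_Suc inverse_eq_divide)
qed simp

lemma sum_inverse_product: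
  assumes "m < c"
  shows   "(\<Sum>i=1..m. 1 / (real i * (real c - real i)))
             = (harm m + harm (c - 1) - harm (c - 1 - m)) / real c"
proof -
  have "(\<Sum>i=1..m. 1 / (real i * (real c - real i)))
      = (\<Sum>i=1..m. (1 / real i + 1 / (real c - real i)) / real c)"
  proof (intro sum.cong refl)
    fix i assume "i \<in> {1..m}"
    hence "real i \<noteq> 0" "real c - real i \<noteq> 0" "real c \<noteq> 0" using assms by auto
    thus "1 / (real i * (real c - real i)) = (1 / real i + 1 / (real c - real i)) / real c"
      by (simp add: add_frac_eq)
  qed
  also have "\<dots> = (harm m + (harm (c - 1) - harm (c - 1 - m))) / real c"
    using sum_reflected_inverse[OF assms]
    by (simp add: sum.distrib harm_def inverse_eq_divide flip: sum_divide_distrib)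
  finally show ?thesis by simp
qed

text \<open>Twice the triangle \<open>l \<le> k \<le> n\<close> of the array
  \<open>1 / (k * l)\<close> is the whole square together with its diagonal.\<close>

lemma sum_harm_div:
  "(\<Sum>k=1..n. harm k / real k) = (harm n ^ 2 + harm2 n) / 2"
proof (induction n)
  case (Suc n)
  have eq: "(\<Sum>k=1..Suc n. harm k / real k) = (\<Sum>k=1..n. harm k / real k) + harm (Suc n) / real (Suc n)"
    by simp
  show ?case unfolding eq Suc.IH harm_Suc harm2_Suc
    by (simp add: field_simps power2_eq_square del: of_nat_Suc)
qed (simp add: harm_def)

text \<open>The left-hand side sums \<open>1/(i l)\<close> over \<open>i \<le> M\<close>, \<open>i + l \<le> 2 M + 2\<close>. Adding its mirror image covers the
  whole triangle \<open>i + l \<le> 2 M + 2\<close> except the point \<open>i = l = M + 1\<close>, and the square \<open>i, l \<le> M\<close> twice.\<close>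
lemma sum_harm_reflected_div:
  "(\<Sum>i=1..M. harm (2 * M + 2 - i) / real i)
     = (harm (2 * M + 2) ^ 2 - harm2 (2 * M + 2) + harm M ^ 2 - 1 / real (M + 1) ^ 2) / 2"
proof (induction M)
  case 0
  show ?case by (simp add: harm_def harm2_def numeral_2_eq_2)
next
  case (Suc M)
  have "(\<Sum>i=1..Suc M. harm (2 * Suc M + 2 - i) / real i)
      = (\<Sum>i=1..M. harm (2 * Suc M + 2 - i) / real i) + harm (M + 3) / (real M + 1)"
    by (simp add: eval_nat_numeral)
  \<comment> \<open>Passing from \<open>M\<close> to \<open>Suc M\<close> raises every harmonic
    argument by two. The two new terms give sums evaluated by \<open>sum_inverse_product\<close>
    with \<open>c = 2 * M + 3\<close> and \<open>c = 2 * M + 4\<close>; the term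
    \<open>i = Suc M\<close> was split off before.\<close>
  also have "(\<Sum>i=1..M. harm (2 * Suc M + 2 - i) / real i)
      = (\<Sum>i=1..M. harm (2 * M + 2 - i) / real i
          + 1 / (real i * (real (2 * M + 3) - real i)) + 1 / (real i * (real (2 * M + 4) - real i)))"
  proof (intro sum.cong refl)
    fix i assume i: "i \<in> {1..M}"
    have "2 * Suc M + 2 - i = Suc (Suc (2 * M + 2 - i))" using i by auto
    hence "(harm (2 * Suc M + 2 - i) :: real) = harm (2 * M + 2 - i) + 1 / (real (2 * M + 3) - real i)
        + 1 / (real (2 * M + 4) - real i)"
      using i by (simp add: harm_Suc inverse_eq_divide of_nat_diff algebra_simps)
    thus "harm (2 * Suc M + 2 - i) / real i = harm (2 * M + 2 - i) / real i
          + 1 / (real i * (real (2 * M + 3) - real i)) + 1 / (real i * (real (2 * M + 4) - real i))"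
      using i by (simp add: add_divide_distrib mult.commute)
  qed
  also have "\<dots> = (harm (2 * M + 2) ^ 2 - harm2 (2 * M + 2) + harm M ^ 2 - 1 / real (M + 1) ^ 2) / 2
      + (harm M + harm (2 * M + 2) - harm (M + 2)) / real (2 * M + 3)
      + (harm M + harm (2 * M + 3) - harm (M + 3)) / real (2 * M + 4)"
    using sum_inverse_product[of M "2 * M + 3"] sum_inverse_product[of M "2 * M + 4"] Suc.IH
    by (simp add: sum.distrib eval_nat_numeral)
  finally have eq: "(\<Sum>i=1..Suc M. harm (2 * Suc M + 2 - i) / real i) = 
      (harm (2 * M + 2) ^ 2 - harm2 (2 * M + 2) + harm M ^ 2 - 1 / real (M + 1) ^ 2) / 2
      + (harm M + harm (2 * M + 2) - harm (M + 2)) / real (2 * M + 3)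
      + (harm M + harm (2 * M + 3) - harm (M + 3)) / real (2 * M + 4)
      + harm (M + 3) / (real M + 1)" .
  define a b x where "a = (harm M :: real)" and "b = (harm (2 * M + 2) :: real)" and "x = real M"
  have x: "x \<ge> 0" by (simp add: x_def)
  have h: "harm (M + 2) = a + 1 / (x + 1) + 1 / (x + 2)" "harm (M + 1) = a + 1 / (x + 1)"
    "harm (M + 3) = a + 1 / (x + 1) + 1 / (x + 2) + 1 / (x + 3)"
    "harm (2 * M + 3) = b + 1 / (2 * x + 3)"
    "harm (2 * M + 4) = b + 1 / (2 * x + 3) + 1 / (2 * x + 4)"
    "harm2 (2 * M + 4) = harm2 (2 * M + 2) + 1 / (2 * x + 3)\<^sup>2 + 1 / (2 * x + 4)\<^sup>2"
    unfolding a_def b_def x_def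
    by (simp_all add: eval_nat_numeral harm_Suc harm2_Suc inverse_eq_divide algebra_simps)
  have s: "2 * Suc M + 2 = 2 * M + 4" "harm (Suc M) = (harm (M + 1) :: real)" "real (2 * M + 3) = 2 * x + 3"
    "real (2 * M + 4) = 2 * (x + 2)" "real (M + 1) = x + 1" "real (Suc M + 1) = x + 2" "real M = x"
    by (simp_all add: x_def)
  have nz: "x + 1 \<noteq> 0" "x + 2 \<noteq> 0" "2 * x + 3 \<noteq> 0" "x + 3 \<noteq> 0" using x by auto
  have "2 * x + 4 = 2 * (x + 2)" by simp
  \<comment> \<open>With \<open>a\<close>, \<open>b\<close> and \<open>c\<close> in place of the
    harmonic numbers, the induction step is an identity of rational functions.\<close>
  have "(b\<^sup>2 - c + a\<^sup>2 - 1 / (x + 1)\<^sup>2) / 2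
      + (a + b - (a + 1 / (x + 1) + 1 / (x + 2))) / (2 * x + 3)
      + (a + (b + 1 / (2 * x + 3)) - (a + 1 / (x + 1) + 1 / (x + 2) + 1 / (x + 3))) / (2 * (x + 2))
      + (a + 1 / (x + 1) + 1 / (x + 2) + 1 / (x + 3)) / (x + 1)
     = ((b + 1 / (2 * x + 3) + 1 / (2 * (x + 2)))\<^sup>2 - (c + 1 / (2 * x + 3)\<^sup>2 + 1 / (2 * (x + 2))\<^sup>2)
         + (a + 1 / (x + 1))\<^sup>2 - 1 / (x + 2)\<^sup>2) / 2" (is "?A c = ?B c") for c
    using nz by (simp add: divide_simps del: distrib_left_numeral) algebra
  from this[of "harm2 (2 * M + 2)"] show ?case
    unfolding eq by (simp only: s h \<open>2 * x + 4 = 2 * (x + 2)\<close> flip: a_def b_def)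
qed

text \<open>The three lines are the limiting contributions of \<open>k = N\<close>,
  \<open>m = N\<close> and \<open>n = N\<close>, with \<zeta>(2) removed from the last. Each sum
  reduces to first and second order harmonic numbers at \<open>N\<close> and \<open>2 * N\<close>;
  all of these cancel and only a rational term in \<open>N\<close> survives.\<close>

lemma residue_identity:
  assumes "N \<ge> 1"
  shows "- (\<Sum>m=1..<N. (1 / (real N - real m) - 1 / (real N + real m)) * (harm (N + m - 1) - harm N))
         + (harm N * (harm (2 * N - 1) - harm N) - (harm (2 * N) - harm N) * harm (N - 1))
         + ((\<Sum>j=1..N. harm (N + j) / (real N + real j))
             + (\<Sum>j=1..<N. (harm (2 * N) - harm (N + j)) / (real N - real j)) - harm2 (2 * N))
         = - 1 / (2 * real N ^ 2)"
proof -
  define a b s t where "a = (harm (2 * N) :: real)" and "b = (harm N :: real)"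
    and "s = harm2 (2 * N)" and "t = harm2 N"
  define x where "x = real N"
  have x: "x > 0" using assms by (simp add: x_def)
  obtain M where M: "N = Suc M" using assms by (cases N) auto
  have h: "harm (N - 1) = b - 1 / x" "harm (2 * N - 1) = a - 1 / (2 * x)"
    using M by (simp_all add: a_def b_def x_def harm_Suc inverse_eq_divide)
  define P where "P = (\<Sum>j=1..<N. harm (N + j) / (real N - real j))"
  define Q where "Q = (\<Sum>j=1..N. harm (N + j) / (real N + real j))"
  define Q' where "Q' = (\<Sum>j=1..<N. harm (N + j) / (real N + real j))"
  define I where "I = (\<Sum>j=1..<N. 1 / (real N - real j))"
  define J where "J = (\<Sum>j=1..<N. 1 / (real N + real j))"
  define S where "S = (\<Sum>j=1..<N. 1 / (real N + real j) ^ 2)"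
  define L where "L = (\<Sum>j=1..<N. 1 / ((real N + real j) * (real N - real j)))"
  have ivl: "{1..<N} = {1..M}" using M by auto
  have I: "I = b - 1 / x"
    using sum_reflected_inverse[of M N] M unfolding I_def ivl h(1)[symmetric]
    by (simp add: harm_def)
  have J: "J = a - 1 / (2 * x) - b"
  proof -
    have "N + M = 2 * N - 1" using M by simp
    thus ?thesis using sum_shifted_inverse[of N M] unfolding J_def ivl h(2)[symmetric] b_def by simp
  qed
  have L: "L = (I + J) / (2 * x)"
  proof -
    have "L = (\<Sum>j=1..<N. (1 / (real N - real j) + 1 / (real N + real j)) / (2 * x))"
      unfolding L_def
    proof (intro sum.cong refl)
      fix j assume "j \<in> {1..<N}"
      hence "real N - real j \<noteq> 0" "real N + real j \<noteq> 0" by auto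
      thus "1 / ((real N + real j) * (real N - real j))
          = (1 / (real N - real j) + 1 / (real N + real j)) / (2 * x)"
        using x by (simp add: add_frac_eq x_def)
    qed
    thus ?thesis by (simp add: I_def J_def sum.distrib flip: sum_divide_distrib)
  qed
  \<comment> \<open>Reflecting \<open>j\<close> to \<open>i = N - j\<close> turns
    \<open>N + j\<close> into \<open>2 * N - i = 2 * M + 2 - i\<close>, the shape of
    \<open>sum_harm_reflected_div\<close>.\<close>
  have P: "P = (a ^ 2 - s + (b - 1 / x) ^ 2 - 1 / x ^ 2) / 2"
  proof -
    have "P = (\<Sum>i=1..M. harm (2 * M + 2 - i) / real i)"
      unfolding P_def ivl
      by (rule sum.reindex_bij_witness[of _ "\<lambda>i. N - i" "\<lambda>i. N - i"])
         (auto simp: M of_nat_diff algebra_simps)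
    thus ?thesis using sum_harm_reflected_div[of M] h M
      by (simp add: a_def s_def x_def b_def)
  qed
  have split: "(\<Sum>k=1..2*N. f k) = (\<Sum>k=1..N. f k) + (\<Sum>j=1..N. f (N + j))" for f :: "nat \<Rightarrow> real"
  proof -
    have "(\<Sum>k=1..N+M. f k) = (\<Sum>k=1..N. f k) + (\<Sum>j=1..M. f (N + j))" for M
      by (induction M) simp_all
    thus ?thesis by (metis mult_2)
  qed
  \<comment> \<open>\<open>Q\<close> is the upper half of the range \<open>1..2*N\<close>, hence a
    difference of two instances of \<open>sum_harm_div\<close>.\<close>
  have Q: "Q = (a ^ 2 + s - b ^ 2 - t) / 2"
    using split[of "\<lambda>k. harm k / real k"] sum_harm_div[of N] sum_harm_div[of "2 * N"]
    by (simp add: Q_def a_def b_def s_def t_def)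
  have last: "(\<Sum>j=1..N. f j) = (\<Sum>j=1..<N. f j) + f N" for f :: "nat \<Rightarrow> real"
    unfolding ivl unfolding M by simp
  have Q': "Q' = Q - a / (2 * x)"
  proof -
    have "harm (N + N) = (harm (2 * N) :: real)" "real N + real N = 2 * x"
      by (simp_all only: x_def mult_2)
    thus ?thesis using last[of "\<lambda>j. harm (N + j) / (real N + real j)"]
      unfolding Q_def Q'_def a_def by simp
  qed
  have S: "S = s - t - 1 / (4 * x ^ 2)"
  proof -
    have "1 / (real N + real N) ^ 2 = 1 / (4 * x ^ 2)" by (simp add: x_def power_mult_distrib)
    thus ?thesis
      using split[of "\<lambda>k. 1 / real k ^ 2"] last[of "\<lambda>j. 1 / (real N + real j) ^ 2"]
      by (simp add: S_def s_def t_def harm2_def)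
  qed
  have 1: "(\<Sum>m=1..<N. (1 / (real N - real m) - 1 / (real N + real m)) * (harm (N + m - 1) - harm N))
      = P - L - b * I - Q' + S + b * J"
  proof -
    \<comment> \<open>Used with \<open>d = N - m\<close>, \<open>e = N + m\<close> and
      \<open>h = harm (N + m)\<close>, where \<open>harm (N + m - 1) = h - 1 / e\<close>; the six
      terms sum to the quantities named above.\<close>
    have expand: "(1 / d - 1 / e) * (h - 1 / e - b)
        = h / d - 1 / (e * d) - b * (1 / d) - h / e + 1 / e ^ 2 + b * (1 / e)" for d e h b :: real
      by (simp add: algebra_simps power2_eq_square)
    have "(\<Sum>m=1..<N. (1 / (real N - real m) - 1 / (real N + real m)) * (harm (N + m - 1) - harm N))
      = (\<Sum>m=1..<N. harm (N + m) / (real N - real m) - 1 / ((real N + real m) * (real N - real m))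
          - b * (1 / (real N - real m)) - harm (N + m) / (real N + real m)
          + 1 / (real N + real m) ^ 2 + b * (1 / (real N + real m)))"
    proof (intro sum.cong refl)
      fix m assume m: "m \<in> {1..<N}"
      hence "harm (N + m - 1) = harm (N + m) - 1 / (real N + real m)"
        by (cases m) (simp_all add: harm_Suc inverse_eq_divide)
      thus "(1 / (real N - real m) - 1 / (real N + real m)) * (harm (N + m - 1) - harm N)
        = harm (N + m) / (real N - real m) - 1 / ((real N + real m) * (real N - real m))
          - b * (1 / (real N - real m)) - harm (N + m) / (real N + real m)
          + 1 / (real N + real m) ^ 2 + b * (1 / (real N + real m))"
        by (simp only: expand b_def)
    qed
    also have "\<dots> = P - L - b * I - Q' + S + b * J"
      by (simp add: P_def L_def I_def Q'_def S_def J_def sum.distrib sum_subtractf sum_distrib_left)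
    finally show ?thesis .
  qed
  have 2: "(\<Sum>j=1..<N. (harm (2 * N) - harm (N + j)) / (real N - real j)) = a * I - P"
    by (simp add: a_def P_def I_def diff_divide_distrib sum_subtractf sum_distrib_left)
  show ?thesis
    unfolding 1 unfolding 2 unfolding Q_def[symmetric] unfolding h a_def[symmetric]
      b_def[symmetric] s_def[symmetric] x_def[symmetric] unfolding Q' S L unfolding J I P Q
    using x by (simp add: field_simps power2_eq_square)
qed

subsection \<open>Residues and their limits\<close>

lemma harm_diff_le:
  assumes "m > 0"
  shows   "harm (m + n) - harm m \<le> real n / real m"
proof -
  have "(\<Sum>j=1..n. 1 / (real m + real j)) \<le> (\<Sum>j=1..n. 1 / real m)"
    using assms by (intro sum_mono) (simp add: frac_le)
  thus ?thesis unfolding sum_shifted_inverse by simp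
qed

lemma harm_add_le: "harm (m + n) \<le> harm m + (harm n :: real)"
proof -
  have "(\<Sum>j=1..n. 1 / (real m + real j)) \<le> (\<Sum>j=1..n. 1 / real j)"
    by (intro sum_mono) (simp add: frac_le)
  thus ?thesis unfolding sum_shifted_inverse by (simp add: harm_def inverse_eq_divide)
qed

text \<open>A bound weaker than logarithmic is enough: multiplied by \<open>N^-u\<close> with
  \<open>u \<ge> 2\<close> it leaves the summable \<open>N^(-3/2)\<close>.\<close>

lemma harm_le_sqrt: "harm n \<le> 2 * sqrt (real n)"
proof (induction n)
  case (Suc n)
  define a b where "a = sqrt (real n)" and "b = sqrt (real (Suc n))"
  have b: "b > 0" "b ^ 2 = real (Suc n)" "a \<ge> 0" "a ^ 2 = real n" by (simp_all add: a_def b_def)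
  \<comment> \<open>Since \<open>b^2 - a^2 = 1\<close>, this gives
    \<open>1 / b \<le> 2 * (b - a)\<close>, so the square roots grow fast enough to absorb the new
    term.\<close>
  have "a * b \<le> (a ^ 2 + b ^ 2) / 2" using sum_squares_bound[of a b] by simp
  hence "1 \<le> 2 * b * (b - a)" using b by (simp add: algebra_simps power2_eq_square)
  hence "1 / b \<le> 2 * (b - a)" using b by (simp add: pos_divide_le_eq mult_ac)
  moreover have "1 / b ^ 2 \<le> 1 / b"
    using b power_increasing[of 1 2 b] by (intro frac_le) (auto simp: b_def)
  ultimately have "1 / b ^ 2 \<le> 2 * (b - a)" by simp
  thus ?case using Suc.IH b by (simp add: harm_Suc inverse_eq_divide a_def b_def)
qed (simp add: harm_def)

lemma tendsto_harm_diff: "(\<lambda>K. harm (K + n) - harm K :: real) \<longlonglongrightarrow> 0"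
proof (rule tendsto_sandwich)
  show "eventually (\<lambda>K. 0 \<le> (harm (K + n) - harm K :: real)) sequentially"
    by (simp add: harm_mono)
  show "eventually (\<lambda>K. harm (K + n) - harm K \<le> real n / real K) sequentially"
    using eventually_gt_at_top[of 0] by eventually_elim (rule harm_diff_le)
  show "(\<lambda>K. real n / real K) \<longlonglongrightarrow> 0" by (rule lim_const_over_n)
qed simp

section \<open>Series whose values are harmonic numbers\<close>

lemma sums_inverse_diff_shift:
  "(\<lambda>p. 1 / (real p + 1) - 1 / (real p + 1 + real q)) sums harm q"
proof -
  have "(\<Sum>p<M. 1 / (real p + 1) - 1 / (real p + 1 + real q)) = harm q - (harm (M + q) - harm M)" for M
    by (induction M) (simp_all add: harm_Suc harm_expand inverse_eq_divide algebra_simps)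
  thus ?thesis using tendsto_diff[OF tendsto_const tendsto_harm_diff[of q], of "harm q"]
    by (simp add: sums_def)
qed

text \<open>By partial fractions this is the difference of the telescoping series for
  \<open>r\<close> and for \<open>q\<close>, divided by \<open>r - q\<close>.\<close>

lemma sums_inverse_product_shift:
  assumes "q < r"
  shows "(\<lambda>p. 1 / ((real p + 1 + real q) * (real p + 1 + real r)))
           sums ((harm r - harm q) / (real r - real q))"
proof -
  have "(\<lambda>p. ((1 / (real p + 1) - 1 / (real p + 1 + real r))
            - (1 / (real p + 1) - 1 / (real p + 1 + real q))) / (real r - real q))
          sums ((harm r - harm q) / (real r - real q))"
    by (intro sums_divide sums_diff sums_inverse_diff_shift)
  moreover have "((1 / (real p + 1) - 1 / (real p + 1 + real r))
            - (1 / (real p + 1) - 1 / (real p + 1 + real q))) / (real r - real q)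
      = 1 / ((real p + 1 + real q) * (real p + 1 + real r))" for p
  proof -
    have "real p + 1 + real r \<noteq> 0" "real p + 1 + real q \<noteq> 0" "real r - real q \<noteq> 0"
      using assms by auto
    thus ?thesis by (simp add: divide_simps) (simp add: algebra_simps)
  qed
  ultimately show ?thesis by simp
qed

definition zeta2 :: real where "zeta2 = (\<Sum>p. 1 / real (Suc p) ^ 2)"

lemma sums_zeta2: "(\<lambda>p. 1 / real (Suc p) ^ 2) sums zeta2"
proof -
  have "summable (\<lambda>p. inverse (real (Suc p) ^ 2))"
    using inverse_power_summable[of 2, where 'a=real] by (subst summable_Suc_iff) simp
  thus ?thesis unfolding zeta2_def by (simp add: summable_sums inverse_eq_divide)
qed

lemma sums_inverse_square_shift:
  "(\<lambda>p. 1 / ((real p + 1 + real q) * (real p + 1 + real q))) sums (zeta2 - harm2 q)"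
proof -
  have "(\<Sum>p<q. 1 / real (Suc p) ^ 2) = harm2 q"
    by (induction q) (simp_all add: harm2_Suc)
  moreover have "(\<lambda>p. 1 / real (Suc (p + q)) ^ 2) sums (zeta2 - (\<Sum>p<q. 1 / real (Suc p) ^ 2))"
    by (subst sums_iff_shift) (use sums_zeta2 in simp)
  ultimately show ?thesis by (simp add: power2_eq_square algebra_simps)
qed

text \<open>The contributions, with the sign reversed, to the coefficient of \<open>N^-u\<close> of the triples \<open>K \<ge> k > m > n > 0\<close> with \<open>k = N\<close>,
  \<open>m = N\<close> and \<open>n = N\<close>, respectively.\<close>
definition res_top :: "nat \<Rightarrow> real" where
  "res_top N = (\<Sum>m=1..<N. \<Sum>n=1..<m.
     - (1 / (real N - real m) - 1 / (real N + real m)) * (1 / (real N + real n)))"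

definition res_mid :: "nat \<Rightarrow> nat \<Rightarrow> real" where
  "res_mid N K = (\<Sum>k\<in>{N<..K}. \<Sum>n=1..<N.
     (1 / (real k - real N) - 1 / real k) * (1 / (real N + real n))
     - (1 / real k - 1 / (real k + real N)) * (1 / (real N - real n)))"

definition res_bot :: "nat \<Rightarrow> nat \<Rightarrow> real" where
  "res_bot N K = (\<Sum>m\<in>{N<..K}. \<Sum>k\<in>{m<..K}.
     (1 / (real m - real N) + 1 / (real m + real N)) * (1 / real k - 1 / (real k + real N)))"

text \<open>The value at \<open>K = \<infinity>\<close> of \<open>res_bot N K\<close>. The first sum
  stems from the factor \<open>1 / (m - N)\<close>, the other two parts from
  \<open>1 / (m + N)\<close>; the last one is a tail of \<zeta>(2), arising where two linear factors
  coincide.\<close>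

definition res_bot_lim :: "nat \<Rightarrow> real" where
  "res_bot_lim N = (\<Sum>j=1..N. harm (N + j) / (real N + real j))
     + (\<Sum>j=1..<N. (harm (2 * N) - harm (N + j)) / (real N - real j)) + (zeta2 - harm2 (2 * N))"

text \<open>The closed form of \<open>res_mid N K\<close> with the differences of harmonic numbers
  at \<open>K - N\<close>, \<open>K\<close> and \<open>K + N\<close> set to zero.\<close>

definition res_mid_lim :: "nat \<Rightarrow> real" where
  "res_mid_lim N = harm N * (harm (2 * N - 1) - harm N) - (harm (2 * N) - harm N) * harm (N - 1)"

section \<open>Closed forms of the truncated residues\<close>

lemma sum_inverse_add_lessThan:
  assumes "m \<ge> 1"
  shows "(\<Sum>n=1..<m. 1 / (real N + real n)) = harm (N + m - 1) - harm N"
  using assms sum_shifted_inverse[of N "m - 1"] by (cases m) (simp_all add: atLeastLessThanSuc_atLeastAtMost)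

lemma sum_inverse_diff_lessThan:
  assumes "N \<ge> 1"
  shows "(\<Sum>n=1..<N. 1 / (real N - real n)) = harm (N - 1)"
  using assms sum_reflected_inverse[of "N - 1" N]
  by (cases N) (simp_all add: atLeastLessThanSuc_atLeastAtMost harm_expand)

lemma sum_inverse_shift_greaterThanAtMost:
  assumes "m \<le> K"
  shows "(\<Sum>k\<in>{m<..K}. 1 / (real k + real N)) = harm (K + N) - harm (m + N)"
  using assms
proof (induction rule: dec_induct)
  case (step n)
  have "{m<..Suc n} = insert (Suc n) {m<..n}" using step by auto
  with step show ?case by (simp add: harm_Suc inverse_eq_divide)
qed simp

lemma sum_inverse_diff_greaterThanAtMost:
  assumes "N \<le> K"
  shows "(\<Sum>k\<in>{N<..K}. 1 / (real k - real N)) = harm (K - N)"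
  using assms
proof (induction rule: dec_induct)
  case (step n)
  have "{N<..Suc n} = insert (Suc n) {N<..n}" using step by auto
  with step show ?case by (simp add: harm_Suc inverse_eq_divide Suc_diff_le of_nat_diff)
qed (simp add: harm_expand)

lemma res_top_eq:
  "res_top N = - (\<Sum>m=1..<N. (1 / (real N - real m) - 1 / (real N + real m)) * (harm (N + m - 1) - harm N))"
  unfolding res_top_def sum_negf[symmetric]
  by (intro sum.cong refl, subst sum_distrib_left[symmetric], subst sum_inverse_add_lessThan) (auto simp del: minus_diff_eq)

text \<open>Both terms of the summand are a function of \<open>k\<close> times a function of
  \<open>n\<close>, so the double sum factors into sums of reciprocals.\<close>

lemma res_mid_eq:
  assumes "1 \<le> N" "N \<le> K"
  shows "res_mid N K = (harm (K - N) - harm K + harm N) * (harm (2 * N - 1) - harm N)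
           - (harm K - harm N - (harm (K + N) - harm (2 * N))) * harm (N - 1)"
proof -
  have "res_mid N K
     = (\<Sum>k\<in>{N<..K}. 1 / (real k - real N) - 1 / real k) * (\<Sum>n=1..<N. 1 / (real N + real n))
     - (\<Sum>k\<in>{N<..K}. 1 / real k - 1 / (real k + real N)) * (\<Sum>n=1..<N. 1 / (real N - real n))"
    by (simp only: res_mid_def sum_product) (simp only: sum_subtractf)
  moreover have "N + N = 2 * N" by simp
  ultimately show ?thesis
    using assms by (simp only: sum_subtractf sum_inverse_add_lessThan sum_inverse_diff_lessThan
        sum_greaterThanAtMost_inverse sum_inverse_shift_greaterThanAtMost
        sum_inverse_diff_greaterThanAtMost) simp
qed

text \<open>The inner sum over \<open>k\<close> is
  \<open>(harm (m + N) - harm m) - (harm (K + N) - harm K)\<close>. Splitting off the second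
  bracket, which is free of \<open>m\<close>, leaves a partial sum of a fixed series minus a
  truncation error.\<close>

lemma res_bot_eq:
  "res_bot N K = (\<Sum>m\<in>{N<..K}. (1 / (real m - real N) + 1 / (real m + real N)) * (harm (m + N) - harm m))
     - (\<Sum>m\<in>{N<..K}. 1 / (real m - real N) + 1 / (real m + real N)) * (harm (K + N) - harm K)"
proof -
  have "res_bot N K = (\<Sum>m\<in>{N<..K}. (1 / (real m - real N) + 1 / (real m + real N))
      * ((harm K - harm m) - (harm (K + N) - harm (m + N))))"
    unfolding res_bot_def
    by (intro sum.cong refl) (simp add: sum_subtractf sum_greaterThanAtMost_inverse
          sum_inverse_shift_greaterThanAtMost flip: sum_distrib_left)
  also have "\<dots> = (\<Sum>m\<in>{N<..K}.
        (1 / (real m - real N) + 1 / (real m + real N)) * (harm (m + N) - harm m)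
      - (1 / (real m - real N) + 1 / (real m + real N)) * (harm (K + N) - harm K))"
    by (intro sum.cong refl) (simp only: right_diff_distrib)
  finally show ?thesis by (simp only: sum_subtractf sum_distrib_right)
qed

section \<open>Limits of the residues as the truncation grows\<close>

text \<open>Here \<open>p = m - N - 1\<close>. Writing the harmonic difference as the sum of
  \<open>1 / (p + 1 + N + j)\<close> over \<open>j \<le> N\<close> yields products of two shifted
  reciprocals, each summed in closed form; the shifts agree only for \<open>2 * N\<close> and
  \<open>j = N\<close>, which gives the series of squares.\<close>

lemma sums_res_bot_lim:
  assumes "N \<ge> 1"
  shows "(\<lambda>p. (1 / (real p + 1) + 1 / (real p + 1 + 2 * real N)) * (harm (p + 1 + 2 * N) - harm (p + 1 + N)))
           sums res_bot_lim N"
proof -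
  have 1: "(\<lambda>p. \<Sum>j=1..N. 1 / ((real p + 1) * (real p + 1 + real (N + j))))
        sums (\<Sum>j=1..N. harm (N + j) / (real N + real j))"
  proof (intro sums_sum)
    fix j assume "j \<in> {1..N}"
    thus "(\<lambda>p. 1 / ((real p + 1) * (real p + 1 + real (N + j)))) sums (harm (N + j) / (real N + real j))"
      using sums_inverse_product_shift[of 0 "N + j"] by (simp add: harm_expand)
  qed
  have 2: "(\<lambda>p. \<Sum>j=1..<N. 1 / ((real p + 1 + real (N + j)) * (real p + 1 + real (2 * N))))
        sums (\<Sum>j=1..<N. (harm (2 * N) - harm (N + j)) / (real N - real j))"
  proof (intro sums_sum)
    fix j assume "j \<in> {1..<N}"
    thus "(\<lambda>p. 1 / ((real p + 1 + real (N + j)) * (real p + 1 + real (2 * N))))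
        sums ((harm (2 * N) - harm (N + j)) / (real N - real j))"
      using sums_inverse_product_shift[of "N + j" "2 * N"] by (simp add: algebra_simps)
  qed
  note sums_add[OF sums_add[OF 1 2] sums_inverse_square_shift[of "2 * N"], folded res_bot_lim_def]
  moreover have "(\<Sum>j=1..N. 1 / ((real p + 1) * (real p + 1 + real (N + j))))
      + (\<Sum>j=1..<N. 1 / ((real p + 1 + real (N + j)) * (real p + 1 + real (2 * N))))
      + 1 / ((real p + 1 + real (2 * N)) * (real p + 1 + real (2 * N)))
    = (1 / (real p + 1) + 1 / (real p + 1 + 2 * real N)) * (harm (p + 1 + 2 * N) - harm (p + 1 + N))" for p
  proof -
    define e where "e j = real p + 1 + real (N + j)" for j
    have h: "harm (p + 1 + 2 * N) - harm (p + 1 + N) = (\<Sum>j=1..N. 1 / e j)"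
      using sum_shifted_inverse[of "p + 1 + N" N, symmetric]
      by (simp add: e_def algebra_simps mult_2_right)
    \<comment> \<open>Puts the separately treated term \<open>j = N\<close> back into the
      sum.\<close>
    have last: "(\<Sum>j=1..<N. f j) + f N = (\<Sum>j=1..N. f j)" for f :: "nat \<Rightarrow> real"
      using assms by (cases N) (simp_all add: atLeastLessThanSuc_atLeastAtMost)
    have eN: "real p + 1 + real (2 * N) = e N" "real p + 1 + 2 * real N = e N"
      by (simp_all add: e_def)
    show ?thesis
      unfolding h unfolding eN unfolding e_def[symmetric]
      unfolding add.assoc[of "sum _ _"] last[of "\<lambda>j. 1 / (e j * e N)"]
      unfolding distrib_right[of "1 / _"] by (simp add: sum_distrib_left mult.commute)
  qed
  ultimately show ?thesis by simp
qed

lemma res_bot_main_eq: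
  "(\<Sum>m\<in>{N<..K}. (1 / (real m - real N) + 1 / (real m + real N)) * (harm (m + N) - harm m))
    = (\<Sum>p<K - N. (1 / (real p + 1) + 1 / (real p + 1 + 2 * real N)) * (harm (p + 1 + 2 * N) - harm (p + 1 + N)))"
  by (rule sum.reindex_bij_witness[of _ "\<lambda>p. p + 1 + N" "\<lambda>m. m - 1 - N"])
     (auto simp: of_nat_diff algebra_simps Suc_diff_Suc mult_2)

lemma res_bot_nonneg: "0 \<le> res_bot N K"
  unfolding res_bot_def by (intro sum_nonneg mult_nonneg_nonneg) (auto simp: frac_le)

text \<open>The truncation error is nonnegative and subtracted, and the main part is a partial sum
  of a series with nonnegative terms.\<close>

lemma res_bot_le:
  assumes "N \<ge> 1"
  shows "res_bot N K \<le> res_bot_lim N"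
proof -
  have "res_bot N K \<le> (\<Sum>p<K - N. (1 / (real p + 1) + 1 / (real p + 1 + 2 * real N))
           * (harm (p + 1 + 2 * N) - harm (p + 1 + N)))"
    unfolding res_bot_eq res_bot_main_eq[symmetric]
    by (auto intro!: mult_nonneg_nonneg sum_nonneg simp: harm_mono)
  also have "\<dots> \<le> res_bot_lim N"
    unfolding sums_unique[OF sums_res_bot_lim[OF assms]]
    by (intro sum_le_suminf sums_summable[OF sums_res_bot_lim[OF assms]])
       (auto intro!: mult_nonneg_nonneg simp: harm_mono)
  finally show ?thesis .
qed

lemma tendsto_res_bot:
  assumes "N \<ge> 1"
  shows "res_bot N \<longlonglongrightarrow> res_bot_lim N"
proof -
  have shift: "filterlim (\<lambda>K. K - N) at_top (at_top :: nat filter)"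
    by (rule filterlim_minus_const_nat_at_top)
  have main: "(\<lambda>K. \<Sum>p<K - N. (1 / (real p + 1) + 1 / (real p + 1 + 2 * real N))
           * (harm (p + 1 + 2 * N) - harm (p + 1 + N))) \<longlonglongrightarrow> res_bot_lim N"
    using filterlim_compose[OF sums_res_bot_lim[OF assms, unfolded sums_def] shift] .
  \<comment> \<open>The truncation error: the sum is at most \<open>2 * harm K\<close>, hence of
    order \<open>sqrt K\<close>, while the harmonic difference is at most
    \<open>N / K\<close>.\<close>
  have "(\<lambda>K. (\<Sum>m\<in>{N<..K}. 1 / (real m - real N) + 1 / (real m + real N))
         * (harm (K + N) - harm K)) \<longlonglongrightarrow> 0"
  proof (rule tendsto_sandwich)
    show "eventually (\<lambda>K. 0 \<le> (\<Sum>m\<in>{N<..K}. 1 / (real m - real N) + 1 / (real m + real N))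
         * (harm (K + N) - harm K)) sequentially"
      by (auto intro!: always_eventually mult_nonneg_nonneg sum_nonneg simp: harm_mono)
    show "eventually (\<lambda>K. (\<Sum>m\<in>{N<..K}. 1 / (real m - real N) + 1 / (real m + real N))
         * (harm (K + N) - harm K) \<le> 4 * real N / sqrt (real K)) sequentially"
      using eventually_ge_at_top[of N]
    proof eventually_elim
      case (elim K)
      have "(\<Sum>m\<in>{N<..K}. 1 / (real m - real N) + 1 / (real m + real N))
          \<le> (\<Sum>m\<in>{N<..K}. 1 / (real m - real N) + 1 / (real m - real N))"
        by (intro sum_mono add_left_mono frac_le) auto
      also have "\<dots> = 2 * harm (K - N)"
        using elim by (simp only: sum.distrib sum_inverse_diff_greaterThanAtMost mult_2)
      also have "\<dots> \<le> 2 * harm K" by (simp add: harm_mono)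
      also have "\<dots> \<le> 4 * sqrt (real K)" using harm_le_sqrt[of K] by simp
      finally have "(\<Sum>m\<in>{N<..K}. 1 / (real m - real N) + 1 / (real m + real N))
         * (harm (K + N) - harm K) \<le> 4 * sqrt (real K) * (real N / real K)"
        using elim assms by (intro mult_mono harm_diff_le) (auto simp: harm_mono)
      also have "\<dots> = 4 * real N / sqrt (real K)"
        using elim assms by (simp add: field_simps flip: power2_eq_square)
      finally show ?case .
    qed
    show "(\<lambda>K. 4 * real N / sqrt (real K)) \<longlonglongrightarrow> 0"
      by (intro tendsto_divide_0[OF tendsto_const] filterlim_at_top_imp_at_infinity
            filterlim_compose[OF sqrt_at_top filterlim_real_sequentially])
  qed simp
  from tendsto_diff[OF main this] show ?thesis
    unfolding res_bot_eq[abs_def] res_bot_main_eq by simp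
qed

lemma tendsto_res_mid:
  assumes "N \<ge> 1"
  shows "res_mid N \<longlonglongrightarrow> res_mid_lim N"
proof -
  have 1: "(\<lambda>K. harm (K + N) - harm K :: real) \<longlonglongrightarrow> 0" by (rule tendsto_harm_diff)
  \<comment> \<open>With truncated subtraction \<open>(K - N) + N\<close> is \<open>K\<close> only
    from \<open>K = N\<close> on, hence the eventual equality below.\<close>
  have "(\<lambda>K. harm ((K - N) + N) - harm (K - N) :: real) \<longlonglongrightarrow> 0"
    by (rule filterlim_compose[OF 1 filterlim_minus_const_nat_at_top])
  hence 2: "(\<lambda>K. harm K - harm (K - N) :: real) \<longlonglongrightarrow> 0"
    by (rule Lim_transform_eventually) (use eventually_ge_at_top[of N] in eventually_elim, simp)
  have "(\<lambda>K. (harm N - (harm K - harm (K - N) :: real)) * (harm (2 * N - 1) - harm N)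
           - ((harm (2 * N) - harm N) - (harm (K + N) - harm K)) * harm (N - 1)) \<longlonglongrightarrow>
        (harm N - 0) * (harm (2 * N - 1) - harm N) - ((harm (2 * N) - harm N) - 0) * harm (N - 1)"
    by (rule tendsto_diff[OF tendsto_mult[OF tendsto_diff[OF tendsto_const 2] tendsto_const]
          tendsto_mult[OF tendsto_diff[OF tendsto_const 1] tendsto_const]])
  hence "(\<lambda>K. (harm N - (harm K - harm (K - N))) * (harm (2 * N - 1) - harm N)
           - ((harm (2 * N) - harm N) - (harm (K + N) - harm K)) * harm (N - 1)) \<longlonglongrightarrow> res_mid_lim N"
    unfolding res_mid_lim_def by simp
  moreover have "eventually (\<lambda>K. (harm N - (harm K - harm (K - N))) * (harm (2 * N - 1) - harm N)
           - ((harm (2 * N) - harm N) - (harm (K + N) - harm K)) * harm (N - 1) = res_mid N K) sequentially"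
    using eventually_ge_at_top[of N]
    by eventually_elim (simp only: res_mid_eq[OF assms], simp add: algebra_simps)
  ultimately show ?thesis by (rule Lim_transform_eventually)
qed

lemma residue_limit:
  assumes "N \<ge> 1"
  shows "res_top N + res_mid_lim N + res_bot_lim N = zeta2 - 1 / (2 * real N ^ 2)"
  using residue_identity[OF assms] unfolding res_top_eq res_mid_lim_def res_bot_lim_def by simp

section \<open>Bounds uniform in the truncation\<close>

text \<open>The harmonic difference is at most \<open>(m - 1) / N \<le> 1\<close>, which leaves the
  sum of \<open>1 / (N - m)\<close>, a harmonic number.\<close>

lemma abs_res_top_le: "\<bar>res_top N\<bar> \<le> harm N"
proof (cases "N = 0")
  case False
  have "\<bar>res_top N\<bar> \<le> (\<Sum>m=1..<N. \<bar>(1 / (real N - real m) - 1 / (real N + real m)) * (harm (N + m - 1) - harm N)\<bar>)"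
    unfolding res_top_eq abs_minus by (rule sum_abs)
  also have "\<dots> \<le> (\<Sum>m=1..<N. 1 / (real N - real m) * 1)"
  proof (rule sum_mono)
    fix m assume m: "m \<in> {1..<N}"
    have "harm (N + (m - 1)) - harm N \<le> real (m - 1) / real N"
      using False by (intro harm_diff_le) auto
    also have "\<dots> \<le> 1" using m by auto
    finally have "\<bar>harm (N + m - 1) - harm N\<bar> \<le> (1::real)" using m harm_mono[of N "N + m - 1", where 'a=real] by auto
    moreover have "\<bar>1 / (real N - real m) - 1 / (real N + real m)\<bar> \<le> 1 / (real N - real m)"
      using m by (auto simp: frac_le abs_if)
    ultimately show "\<bar>(1 / (real N - real m) - 1 / (real N + real m)) * (harm (N + m - 1) - harm N)\<bar>
        \<le> 1 / (real N - real m) * 1"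
      unfolding abs_mult by (intro mult_mono) (use m in auto)
  qed
  also have "\<dots> = harm (N - 1)" using False by (simp add: sum_inverse_diff_lessThan del: One_nat_def)
  also have "\<dots> \<le> harm N" by (simp add: harm_mono)
  finally show ?thesis .
qed (simp add: res_top_def harm_def)

text \<open>In each of the two products of \<open>res_mid_eq\<close> one factor is at most
  \<open>harm N\<close> and the other at most 1 in absolute value.\<close>

lemma abs_res_mid_le:
  assumes "1 \<le> N" "N \<le> K"
  shows "\<bar>res_mid N K\<bar> \<le> 2 * harm N"
proof -
  have 1: "\<bar>harm (K - N) - harm K + harm N\<bar> \<le> (harm N :: real)"
    using harm_add_le[of "K - N" N] harm_mono[of "K - N" K, where 'a=real] assms by auto
  have d: "harm (2 * N) - harm N \<le> (1::real)"
    using harm_diff_le[of N N] assms by (simp add: mult_2)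
  hence 2: "\<bar>harm (2 * N - 1) - harm N\<bar> \<le> (1::real)"
    using harm_mono[of N "2 * N - 1", where 'a=real] harm_mono[of "2 * N - 1" "2 * N", where 'a=real] assms
    by auto
  have "harm (K + N) - harm K \<le> real N / real K" using assms by (intro harm_diff_le) auto
  also have "\<dots> \<le> 1" using assms by auto
  finally have 3: "\<bar>harm K - harm N - (harm (K + N) - harm (2 * N))\<bar> \<le> (1::real)"
    using d harm_mono[of K "K + N", where 'a=real] harm_mono[of N "2 * N", where 'a=real] by auto
  have 4: "\<bar>harm (N - 1)\<bar> \<le> (harm N :: real)" by (simp add: harm_mono)
  have "\<bar>res_mid N K\<bar> \<le> \<bar>(harm (K - N) - harm K + harm N) * (harm (2 * N - 1) - harm N)\<bar>
      + \<bar>(harm K - harm N - (harm (K + N) - harm (2 * N))) * harm (N - 1)\<bar>"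
    unfolding res_mid_eq[OF assms] by (rule abs_triangle_ineq4)
  also have "\<dots> \<le> harm N * 1 + 1 * harm N"
    unfolding abs_mult using 1 2 3 4 by (intro add_mono mult_mono) (auto simp: harm_nonneg)
  finally show ?thesis by simp
qed

lemma abs_res_mid_lim_le:
  assumes "N \<ge> 1"
  shows "\<bar>res_mid_lim N\<bar> \<le> 2 * harm N"
proof (rule tendsto_upperbound)
  show "(\<lambda>K. \<bar>res_mid N K\<bar>) \<longlonglongrightarrow> \<bar>res_mid_lim N\<bar>"
    by (intro tendsto_rabs tendsto_res_mid assms)
  show "eventually (\<lambda>K. \<bar>res_mid N K\<bar> \<le> 2 * harm N) sequentially"
    using eventually_ge_at_top[of N] by eventually_elim (rule abs_res_mid_le[OF assms])
qed simp

text \<open>The bottom piece lies between 0 and its limit, and \<open>residue_limit\<close> controls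
  that limit by \<zeta>(2) and the other two pieces. Six copies of
  \<open>harm N \<le> 2 * sqrt N\<close> cover both signs, whence the 12.\<close>

lemma abs_residue_le:
  assumes "1 \<le> N" "N \<le> K"
  shows "\<bar>res_top N + res_mid N K + res_bot N K\<bar> \<le> zeta2 + 12 * sqrt (real N)"
proof -
  have "0 \<le> 1 / (2 * real N ^ 2)" by simp
  thus ?thesis
    using residue_limit[OF assms(1)] abs_res_top_le[of N] abs_res_mid_le[OF assms]
      abs_res_mid_lim_le[OF assms(1)] res_bot_nonneg[of N K] res_bot_le[OF assms(1), of K] harm_le_sqrt[of N]
    by linarith
qed

subsection \<open>Multiple zeta values as limits of truncated sums\<close>

definition triples :: "(nat \<times> nat \<times> nat) set" where
  "triples = {(k, m, n). 0 < n \<and> n < m \<and> m < k}"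

definition triples_upto :: "nat \<Rightarrow> (nat \<times> nat \<times> nat) set" where
  "triples_upto K = {(k, m, n). 0 < n \<and> n < m \<and> m < k \<and> k \<le> K}"

lemma finite_triples_upto [simp]: "finite (triples_upto K)"
  by (rule finite_subset[of _ "{..K} \<times> {..K} \<times> {..K}"]) (auto simp: triples_upto_def)

text \<open>Turns an unordered sum over all triples into the limit of its truncations: a finite set
  of triples lies below its largest first entry.\<close>

lemma filterlim_triples_upto:
  "filterlim triples_upto (finite_subsets_at_top triples) sequentially"
  unfolding filterlim_finite_subsets_at_top
proof (intro allI impI)
  fix X assume X: "finite X \<and> X \<subseteq> triples"
  \<comment> \<open>The inserted 0 keeps the maximum meaningful for empty \<open>X\<close>.\<close>
  define K0 where "K0 = Max (insert 0 (fst ` X))"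
  have "fst x \<le> K0" if "x \<in> X" for x using X that unfolding K0_def by (intro Max_ge) auto
  hence "X \<subseteq> triples_upto K" if "K \<ge> K0" for K
    using X that by (force simp: triples_def triples_upto_def)
  thus "\<forall>\<^sub>F K in sequentially. finite (triples_upto K) \<and> X \<subseteq> triples_upto K \<and> triples_upto K \<subseteq> triples"
    by (intro eventually_sequentiallyI[of K0] conjI finite_triples_upto)
       (auto simp: triples_def triples_upto_def)
qed

lemma summable_on_triple_product:
  fixes g :: "nat \<Rightarrow> real"
  assumes g: "summable g" and nonneg: "\<And>n. g n \<ge> 0"
  shows "(\<lambda>(k, m, n). g k * (g m * g n)) summable_on UNIV"
proof -
  have g': "(g has_sum infsum g UNIV) UNIV"
    using summable_nonneg_imp_summable_on[OF g nonneg] by simp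
  have 1: "(\<lambda>(m, n). g m * g n) summable_on Sigma UNIV (\<lambda>_. UNIV)"
    by (rule summable_on_SigmaI[where g = "\<lambda>m. g m * infsum g UNIV"])
       (auto intro!: has_sum_cmult_right summable_on_cmult_left g' has_sum_imp_summable[OF g'] simp: nonneg)
  hence 1: "((\<lambda>(m, n). g m * g n) has_sum infsum (\<lambda>(m, n). g m * g n) UNIV) UNIV" by simp
  have "(\<lambda>(k, m, n). g k * (g m * g n)) summable_on Sigma UNIV (\<lambda>_. UNIV)"
  proof (rule summable_on_SigmaI[where g = "\<lambda>k. g k * infsum (\<lambda>(m, n). g m * g n) UNIV"])
    fix k :: nat
    show "((\<lambda>y. case (k, y) of (k, m, n) \<Rightarrow> g k * (g m * g n)) has_sum
         (g k * infsum (\<lambda>(m, n). g m * g n) UNIV)) UNIV"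
      using has_sum_cmult_right[OF 1, of "g k"] by (simp add: case_prod_unfold)
  qed (auto intro!: summable_on_cmult_left has_sum_imp_summable[OF g'] simp: nonneg)
  thus ?thesis by simp
qed

text \<open>It suffices to bound \<open>k^-2 m^-1 n^-1\<close>. Write \<open>k^-2\<close> as
  \<open>k^(-4/3) k^(-1/3) k^(-1/3)\<close> and, as \<open>k\<close> is the largest index, replace
  the last two factors by \<open>m^(-1/3)\<close> and \<open>n^(-1/3)\<close>; the result is a
  product of three convergent series.\<close>

lemma summable_on_triples:
  assumes "a \<ge> 2" "b \<ge> 1" "c \<ge> 1"
  shows "(\<lambda>(k, m, n). 1 / real k ^ a * (1 / real m ^ b * (1 / real n ^ c))) summable_on triples"
proof (rule summable_on_comparison_test)
  define g where "g n = real n powr (-4/3)" for n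
  have "summable g" unfolding g_def by (subst summable_real_powr_iff) simp
  hence "(\<lambda>(k, m, n). g k * (g m * g n)) summable_on UNIV"
    by (rule summable_on_triple_product) (simp add: g_def)
  thus "(\<lambda>(k, m, n). g k * (g m * g n)) summable_on triples"
    by (rule summable_on_subset_banach) simp
  fix x assume "x \<in> triples"
  then obtain k m n where x: "x = (k, m, n)" "0 < n" "n < m" "m < k" by (auto simp: triples_def)
  have le: "1 / real j ^ s \<le> 1 / real j ^ t" if "t \<le> s" "j > 0" for j s t :: nat
    using that by (intro divide_left_mono power_increasing) auto
  have "1 / real k ^ a * (1 / real m ^ b * (1 / real n ^ c))
      \<le> 1 / real k ^ 2 * (1 / real m ^ 1 * (1 / real n ^ 1))"
    using x assms by (intro mult_mono le) auto
  also have "\<dots> = real k powr (-4/3) * (real k powr (-1/3) * real m powr (-1) * (real k powr (-1/3) * real n powr (-1)))"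
  proof -
    have "real k powr (-4/3) * (real k powr (-1/3) * real k powr (-1/3)) = real k powr (-2)"
      using x by (simp flip: powr_add)
    also have "\<dots> = 1 / real k ^ 2" using x by (simp add: powr_minus_divide)
    finally show ?thesis using x by (simp add: powr_minus_divide mult_ac)
  qed
  also have "\<dots> \<le> g k * ((real m powr (-1/3) * real m powr (-1)) * (real n powr (-1/3) * real n powr (-1)))"
    unfolding g_def using x by (intro mult_mono mult_nonneg_nonneg powr_mono2') auto
  also have "\<dots> = g k * (g m * g n)" unfolding g_def powr_add[symmetric] by simp
  finally show "(case x of (k, m, n) \<Rightarrow> 1 / real k ^ a * (1 / real m ^ b * (1 / real n ^ c)))
      \<le> (case x of (k, m, n) \<Rightarrow> g k * (g m * g n))"
    using x by simp
  show "0 \<le> (case x of (k, m, n) \<Rightarrow> 1 / real k ^ a * (1 / real m ^ b * (1 / real n ^ c)))"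
    using x by simp
qed

lemma mzv_triple_tendsto:
  assumes "a \<ge> 2" "b \<ge> 1" "c \<ge> 1"
  shows "(\<lambda>K. \<Sum>(k, m, n)\<in>triples_upto K. 1 / real k ^ a * (1 / real m ^ b * (1 / real n ^ c)))
           \<longlonglongrightarrow> mzv [a, b, c]"
proof -
  have "mzv [a, b, c] = (\<Sum>\<^sub>\<infinity>(k, m, n)\<in>triples. 1 / real k ^ a * (1 / real m ^ b * (1 / real n ^ c)))"
    unfolding mzv_def
    by (rule infsum_reindex_bij_witness[of _ "\<lambda>(k, m, n). [k, m, n]" "\<lambda>l. (l ! 0, l ! 1, l ! 2)"])
       (auto simp: triples_def length_Suc_conv eval_nat_numeral lessThan_Suc mult_ac)
  with summable_on_triples[OF assms]
  have "((\<lambda>(k, m, n). 1 / real k ^ a * (1 / real m ^ b * (1 / real n ^ c))) has_sum mzv [a, b, c]) triples"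
    by simp
  from filterlim_compose[OF this[unfolded has_sum_def] filterlim_triples_upto] show ?thesis .
qed

lemma mzv_single_sums:
  assumes "s \<ge> 2"
  shows "(\<lambda>p. 1 / real (Suc p) ^ s) sums mzv [s]"
proof -
  have "mzv [s] = (\<Sum>\<^sub>\<infinity>p. 1 / real (Suc p) ^ s)"
    unfolding mzv_def
    by (rule infsum_reindex_bij_witness[of _ "\<lambda>p. [Suc p]" "\<lambda>l. l ! 0 - 1"])
       (auto simp: length_Suc_conv)
  moreover have "summable (\<lambda>p. inverse (real (Suc p) ^ s))"
    using inverse_power_summable[OF assms, where 'a=real] by (subst summable_Suc_iff)
  hence "(\<lambda>p. 1 / real (Suc p) ^ s) summable_on UNIV"
    by (intro summable_nonneg_imp_summable_on) (simp_all add: inverse_eq_divide)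
  ultimately show ?thesis by (metis has_sum_infsum has_sum_imp_sums)
qed

lemma mzv_2: "mzv [2] = zeta2"
  using sums_unique2[OF mzv_single_sums[of 2] sums_zeta2] by simp

subsection \<open>Partial fractions\<close>

lemma sum_power_mult_power:
  fixes x y :: real
  assumes "x \<noteq> y"
  shows "(\<Sum>b\<le>d. x ^ (d - b) * y ^ b) = (x ^ (d + 1) - y ^ (d + 1)) / (x - y)"
  using diff_power_eq_sum[of y d x] assms
  by (simp add: lessThan_Suc_atMost field_simps)

text \<open>The left side is the complete homogeneous symmetric polynomial of degree
  \<open>d\<close>. Summing a geometric sum over \<open>b\<close> and then two over \<open>c\<close>
  gives its partial fraction form.\<close>

lemma complete_homogeneous_3:
  fixes x y z :: real
  assumes "x \<noteq> y" "x \<noteq> z" "y \<noteq> z"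
  shows "(\<Sum>c\<le>d. \<Sum>b\<le>d - c. x ^ (d - c - b) * y ^ b * z ^ c)
      = x ^ (d + 2) / ((x - y) * (x - z)) + y ^ (d + 2) / ((y - x) * (y - z)) + z ^ (d + 2) / ((z - x) * (z - y))"
proof -
  have "(\<Sum>c\<le>d. \<Sum>b\<le>d - c. x ^ (d - c - b) * y ^ b * z ^ c)
      = (\<Sum>c\<le>d. (x * (x ^ (d - c) * z ^ c) - y * (y ^ (d - c) * z ^ c)) / (x - y))"
    by (intro sum.cong refl, simp only: sum_distrib_right[symmetric] sum_power_mult_power[OF assms(1)])
       (simp add: algebra_simps diff_divide_distrib)
  also have "\<dots> = (x * ((x ^ (d + 1) - z ^ (d + 1)) / (x - z)) - y * ((y ^ (d + 1) - z ^ (d + 1)) / (y - z))) / (x - y)"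
    using assms by (simp add: sum_subtractf sum_power_mult_power flip: sum_divide_distrib sum_distrib_left)
  also have "\<dots> = x ^ (d + 2) / ((x - y) * (x - z)) + y ^ (d + 2) / ((y - x) * (y - z)) + z ^ (d + 2) / ((z - x) * (z - y))"
  proof -
    have "(x * ((p - r) / (x - z)) - y * ((q - r) / (y - z))) / (x - y)
      = (x * p) / ((x - y) * (x - z)) + (y * q) / ((y - x) * (y - z)) + (z * r) / ((z - x) * (z - y))" for p q r
    proof -
      have nz: "x - y \<noteq> 0" "x - z \<noteq> 0" "y - z \<noteq> 0" using assms by auto
      have "(y - x) * (y - z) = - ((x - y) * (y - z))" "(z - x) * (z - y) = (x - z) * (y - z)"
        by (simp_all add: algebra_simps)
      thus ?thesis using nz by (simp add: divide_simps) (simp add: algebra_simps)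
    qed
    \<comment> \<open>The instantiation follows the order of first occurrence: \<open>p\<close>,
      \<open>r\<close>, \<open>q\<close>.\<close>
    from this[of "x ^ (d + 1)" "z ^ (d + 1)" "y ^ (d + 1)"] show ?thesis by simp
  qed
  finally show ?thesis .
qed

text \<open>Pulling out \<open>x^2 * y * z\<close> removes the lower bounds on the exponents. As the
  weight is even, the parity of the reduced exponent of \<open>x\<close> is that of the other two
  together, so one sign is absorbed by negating \<open>z\<close> and the other by negating both
  \<open>y\<close> and \<open>z\<close>.\<close>

lemma signed_sum_eq_complete_homogeneous:
  fixes x y z :: real
  assumes "even d"
  shows "(\<Sum>(a, b, c)\<in>{(a, b, c). a + b + c = d + 4 \<and> a \<ge> 2 \<and> b \<ge> 1 \<and> c \<ge> 1}.
            ((-1) ^ c - (-1) ^ a) * (x ^ a * (y ^ b * z ^ c)))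
     = - (x ^ 2 * y * z) * ((\<Sum>c\<le>d. \<Sum>b\<le>d - c. x ^ (d - c - b) * y ^ b * (-z) ^ c)
                          + (\<Sum>c\<le>d. \<Sum>b\<le>d - c. x ^ (d - c - b) * (-y) ^ b * (-z) ^ c))"
proof -
  have "(\<Sum>(a, b, c)\<in>{(a, b, c). a + b + c = d + 4 \<and> a \<ge> 2 \<and> b \<ge> 1 \<and> c \<ge> 1}.
            ((-1) ^ c - (-1) ^ a) * (x ^ a * (y ^ b * z ^ c)))
     = (\<Sum>(c, b)\<in>Sigma {..d} (\<lambda>c. {..d - c}).
          ((-1) ^ (c + 1) - (-1) ^ (d - c - b + 2)) * (x ^ (d - c - b + 2) * (y ^ (b + 1) * z ^ (c + 1))))"
    by (rule sym, rule sum.reindex_bij_witness[of _ "\<lambda>(a, b, c). (c - 1, b - 1)"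
          "\<lambda>(c, b). (d - c - b + 2, b + 1, c + 1)"]) auto
  also have "\<dots> = (\<Sum>(c, b)\<in>Sigma {..d} (\<lambda>c. {..d - c}).
          - (x ^ 2 * y * z) * (x ^ (d - c - b) * y ^ b * (-z) ^ c + x ^ (d - c - b) * (-y) ^ b * (-z) ^ c))"
  proof (intro sum.cong refl)
    fix t assume "t \<in> Sigma {..d} (\<lambda>c. {..d - c})"
    then obtain c b where t: "t = (c, b)" "c \<le> d" "b \<le> d - c" by auto
    define e where "e = d - c - b"
    have d: "d = e + b + c" using t by (simp add: e_def)
    have "(-1 :: real) ^ e = (-1) ^ (b + c)" using assms unfolding d by (auto simp: minus_one_power_iff)
    hence "((-1) ^ (c + 1) - (-1) ^ (e + 2)) * (x ^ (e + 2) * (y ^ (b + 1) * z ^ (c + 1)))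
        = - (x ^ 2 * y * z) * (x ^ e * y ^ b * (-z) ^ c + x ^ e * (-y) ^ b * (-z) ^ c)"
      by (simp add: power_minus[of y] power_minus[of z] power_add algebra_simps power2_eq_square)
    thus "(case t of (c, b) \<Rightarrow>
          ((-1) ^ (c + 1) - (-1) ^ (d - c - b + 2)) * (x ^ (d - c - b + 2) * (y ^ (b + 1) * z ^ (c + 1))))
        = (case t of (c, b) \<Rightarrow>
          - (x ^ 2 * y * z) * (x ^ (d - c - b) * y ^ b * (-z) ^ c + x ^ (d - c - b) * (-y) ^ b * (-z) ^ c))"
      by (simp only: t prod.case e_def)
  qed
  also have "\<dots> = - (x ^ 2 * y * z) * ((\<Sum>c\<le>d. \<Sum>b\<le>d - c. x ^ (d - c - b) * y ^ b * (-z) ^ c)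
                          + (\<Sum>c\<le>d. \<Sum>b\<le>d - c. x ^ (d - c - b) * (-y) ^ b * (-z) ^ c))"
    by (subst sum.Sigma[symmetric]) (simp_all only: finite_atMost ball_triv simp_thms
          sum_distrib_left[symmetric] sum.distrib)
  finally show ?thesis .
qed

text \<open>Together with \<open>coeff_mid\<close> and \<open>coeff_bot\<close>, the sign-reversed
  coefficients in the partial fractions of a single triple. They do not involve the weight and are
  the summands of \<open>res_top\<close>, \<open>res_mid\<close> and \<open>res_bot\<close>.\<close>

definition coeff_top :: "nat \<Rightarrow> nat \<Rightarrow> nat \<Rightarrow> real" where
  "coeff_top k m n = - (1 / (real k - real m) - 1 / (real k + real m)) * (1 / (real k + real n))"

definition coeff_mid :: "nat \<Rightarrow> nat \<Rightarrow> nat \<Rightarrow> real" where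
  "coeff_mid k m n = (1 / (real k - real m) - 1 / real k) * (1 / (real m + real n))
     - (1 / real k - 1 / (real k + real m)) * (1 / (real m - real n))"

definition coeff_bot :: "nat \<Rightarrow> nat \<Rightarrow> nat \<Rightarrow> real" where
  "coeff_bot k m n = (1 / (real m - real n) + 1 / (real m + real n)) * (1 / real k - 1 / (real k + real n))"

lemma signed_sum_partial_fractions:
  assumes "even d" "0 < n" "n < m" "m < k"
  shows "(\<Sum>(a, b, c)\<in>{(a, b, c). a + b + c = d + 4 \<and> a \<ge> 2 \<and> b \<ge> 1 \<and> c \<ge> 1}.
            ((-1) ^ c - (-1) ^ a) * (1 / real k ^ a * (1 / real m ^ b * (1 / real n ^ c))))
     = - (coeff_top k m n * (1 / real k ^ (d + 2)) + coeff_mid k m n * (1 / real m ^ (d + 2))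
          + coeff_bot k m n * (1 / real n ^ (d + 2)))"
proof -
  define x y z where "x = 1 / real k" and "y = 1 / real m" and "z = 1 / real n"
  define X Y Z where "X = real k" and "Y = real m" and "Z = real n"
  have pos: "0 < Z" "Z < Y" "Y < X" using assms by (auto simp: X_def Y_def Z_def)
  have xyz: "0 < x" "x < y" "y < z" using assms by (auto simp: x_def y_def z_def frac_less2)
  \<comment> \<open>Evenness makes the expansions at \<open>(x, y, -z)\<close> and
    \<open>(x, -y, -z)\<close> involve the same three powers, so they can be added
    coefficientwise.\<close>
  have ev: "(-z) ^ (d + 2) = z ^ (d + 2)" "(-y) ^ (d + 2) = y ^ (d + 2)" using assms by auto
  have inv: "x = 1 / X" "y = 1 / Y" "z = 1 / Z"
    by (simp_all add: x_def y_def z_def X_def Y_def Z_def)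
  have nz: "X \<noteq> 0" "Y \<noteq> 0" "Z \<noteq> 0" "X - Y \<noteq> 0" "X + Y \<noteq> 0" "X + Z \<noteq> 0" "Y + Z \<noteq> 0" "Y - Z \<noteq> 0"
    using pos by auto
  have frac: "x - y = - (X - Y) / (X * Y)" "y - x = (X - Y) / (X * Y)" "x + y = (X + Y) / (X * Y)"
    "x + z = (X + Z) / (X * Z)" "y + z = (Y + Z) / (Y * Z)" "y - z = - (Y - Z) / (Y * Z)"
    "z - y = (Y - Z) / (Y * Z)"
    using nz by (simp_all add: inv field_simps)
  have top: "x ^ 2 * y * z * (1 / ((x - y) * (x + z)) + 1 / ((x + y) * (x + z))) = coeff_top k m n"
    unfolding coeff_top_def X_def[symmetric] Y_def[symmetric] Z_def[symmetric] frac using nz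
    by (simp add: inv divide_simps power2_eq_square) algebra
  have mid: "x ^ 2 * y * z * (1 / ((y - x) * (y + z)) + 1 / ((x + y) * (y - z))) = coeff_mid k m n"
    unfolding coeff_mid_def X_def[symmetric] Y_def[symmetric] Z_def[symmetric] frac using nz
    by (simp add: inv divide_simps power2_eq_square) algebra
  have bot: "x ^ 2 * y * z * (1 / ((x + z) * (y + z)) + 1 / ((x + z) * (z - y))) = coeff_bot k m n"
    unfolding coeff_bot_def X_def[symmetric] Y_def[symmetric] Z_def[symmetric] frac using nz
    by (simp add: inv divide_simps power2_eq_square) algebra
  have h1: "(\<Sum>c\<le>d. \<Sum>b\<le>d - c. x ^ (d - c - b) * y ^ b * (-z) ^ c)
      = x ^ (d + 2) * (1 / ((x - y) * (x + z))) + y ^ (d + 2) * (1 / ((y - x) * (y + z)))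
        + z ^ (d + 2) * (1 / ((x + z) * (y + z)))"
    using complete_homogeneous_3[of x y "-z" d] xyz unfolding ev
    by (simp add: algebra_simps)
  have h2: "(\<Sum>c\<le>d. \<Sum>b\<le>d - c. x ^ (d - c - b) * (-y) ^ b * (-z) ^ c)
      = x ^ (d + 2) * (1 / ((x + y) * (x + z))) + y ^ (d + 2) * (1 / ((x + y) * (y - z)))
        + z ^ (d + 2) * (1 / ((x + z) * (z - y)))"
  proof -
    have "(- y - x) * (- y - - z) = (x + y) * (y - z)" "(- z - x) * (- z - - y) = (x + z) * (z - y)"
      by (simp_all add: algebra_simps)
    thus ?thesis using complete_homogeneous_3[of x "-y" "-z" d] xyz unfolding ev by simp
  qed
  have "(\<Sum>(a, b, c)\<in>{(a, b, c). a + b + c = d + 4 \<and> a \<ge> 2 \<and> b \<ge> 1 \<and> c \<ge> 1}.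
            ((-1) ^ c - (-1) ^ a) * (1 / real k ^ a * (1 / real m ^ b * (1 / real n ^ c))))
      = (\<Sum>(a, b, c)\<in>{(a, b, c). a + b + c = d + 4 \<and> a \<ge> 2 \<and> b \<ge> 1 \<and> c \<ge> 1}.
            ((-1) ^ c - (-1) ^ a) * (x ^ a * (y ^ b * z ^ c)))"
    by (simp add: x_def y_def z_def power_one_over)
  also have "\<dots> = - (coeff_top k m n * x ^ (d + 2) + coeff_mid k m n * y ^ (d + 2) + coeff_bot k m n * z ^ (d + 2))"
  proof -
    have "- q * ((A * p1 + B * p2 + C * p3) + (A * p4 + B * p5 + C * p6))
        = - (q * (p1 + p4) * A + q * (p2 + p5) * B + q * (p3 + p6) * C)"
      for q A B C p1 p2 p3 p4 p5 p6 :: real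
      by (simp add: algebra_simps)
    thus ?thesis
      unfolding signed_sum_eq_complete_homogeneous[OF assms(1)] h1 h2
        top[symmetric] mid[symmetric] bot[symmetric] .
  qed
  finally show ?thesis by (simp add: x_def y_def z_def power_one_over)
qed

section \<open>Collecting the truncated sum by powers\<close>

lemma sum_triples_upto_top:
  "(\<Sum>(k, m, n)\<in>triples_upto K. f k m n) = (\<Sum>k=1..K. \<Sum>m=1..<k. \<Sum>n=1..<m. f k m n)"
  for f :: "nat \<Rightarrow> nat \<Rightarrow> nat \<Rightarrow> real"
  by (simp add: sum.Sigma)
     (rule sum.reindex_bij_witness[of _ "\<lambda>(k, m, n). (k, m, n)" "\<lambda>(k, m, n). (k, m, n)"],
      auto simp: triples_upto_def)

lemma sum_triples_upto_mid:
  "(\<Sum>(k, m, n)\<in>triples_upto K. f k m n) = (\<Sum>m=1..K. \<Sum>k\<in>{m<..K}. \<Sum>n=1..<m. f k m n)"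
  for f :: "nat \<Rightarrow> nat \<Rightarrow> nat \<Rightarrow> real"
  by (simp add: sum.Sigma)
     (rule sum.reindex_bij_witness[of _ "\<lambda>(m, k, n). (k, m, n)" "\<lambda>(k, m, n). (m, k, n)"],
      auto simp: triples_upto_def)

lemma sum_triples_upto_bot:
  "(\<Sum>(k, m, n)\<in>triples_upto K. f k m n) = (\<Sum>n=1..K. \<Sum>m\<in>{n<..K}. \<Sum>k\<in>{m<..K}. f k m n)"
  for f :: "nat \<Rightarrow> nat \<Rightarrow> nat \<Rightarrow> real"
  by (simp add: sum.Sigma)
     (rule sum.reindex_bij_witness[of _ "\<lambda>(n, m, k). (k, m, n)" "\<lambda>(k, m, n). (n, m, k)"],
      auto simp: triples_upto_def)

text \<open>Each coefficient is summed with the variable carrying its power outermost. That variable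
  becomes \<open>N\<close>, and the two inner sums are then the corresponding residue.\<close>

lemma truncated_sum_eq_residues:
  assumes "even d"
  shows "(\<Sum>(k, m, n)\<in>triples_upto K.
      \<Sum>(a, b, c)\<in>{(a, b, c). a + b + c = d + 4 \<and> a \<ge> 2 \<and> b \<ge> 1 \<and> c \<ge> 1}.
            ((-1) ^ c - (-1) ^ a) * (1 / real k ^ a * (1 / real m ^ b * (1 / real n ^ c))))
    = - (\<Sum>N=1..K. (res_top N + res_mid N K + res_bot N K) * (1 / real N ^ (d + 2)))"
proof -
  have "(\<Sum>(k, m, n)\<in>triples_upto K.
      \<Sum>(a, b, c)\<in>{(a, b, c). a + b + c = d + 4 \<and> a \<ge> 2 \<and> b \<ge> 1 \<and> c \<ge> 1}.
            ((-1) ^ c - (-1) ^ a) * (1 / real k ^ a * (1 / real m ^ b * (1 / real n ^ c))))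
     = (\<Sum>(k, m, n)\<in>triples_upto K.
         - (coeff_top k m n * (1 / real k ^ (d + 2)) + coeff_mid k m n * (1 / real m ^ (d + 2))
          + coeff_bot k m n * (1 / real n ^ (d + 2))))"
    by (intro sum.cong refl, clarify, rule signed_sum_partial_fractions[OF assms])
       (auto simp: triples_upto_def)
  also have "\<dots> = - ((\<Sum>(k, m, n)\<in>triples_upto K. coeff_top k m n * (1 / real k ^ (d + 2)))
      + (\<Sum>(k, m, n)\<in>triples_upto K. coeff_mid k m n * (1 / real m ^ (d + 2)))
      + (\<Sum>(k, m, n)\<in>triples_upto K. coeff_bot k m n * (1 / real n ^ (d + 2))))"
    by (simp only: case_prod_unfold sum_negf sum.distrib)
  also have "(\<Sum>(k, m, n)\<in>triples_upto K. coeff_top k m n * (1 / real k ^ (d + 2)))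
      = (\<Sum>N=1..K. res_top N * (1 / real N ^ (d + 2)))"
    unfolding sum_triples_upto_top res_top_def coeff_top_def sum_distrib_right ..
  also have "(\<Sum>(k, m, n)\<in>triples_upto K. coeff_mid k m n * (1 / real m ^ (d + 2)))
      = (\<Sum>N=1..K. res_mid N K * (1 / real N ^ (d + 2)))"
    unfolding sum_triples_upto_mid res_mid_def coeff_mid_def sum_distrib_right ..
  also have "(\<Sum>(k, m, n)\<in>triples_upto K. coeff_bot k m n * (1 / real n ^ (d + 2)))
      = (\<Sum>N=1..K. res_bot N K * (1 / real N ^ (d + 2)))"
    unfolding sum_triples_upto_bot res_bot_def coeff_bot_def sum_distrib_right ..
  finally show ?thesis by (simp only: distrib_right sum.distrib)
qed

section \<open>Passage to the limit\<close>

lemma tendsto_sum_residues: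
  assumes "u \<ge> 2"
  shows "(\<lambda>K. \<Sum>N=1..K. (res_top N + res_mid N K + res_bot N K) * (1 / real N ^ u))
           \<longlonglongrightarrow> mzv [2] * mzv [u] - 1 / 2 * mzv [u + 2]"
proof -
  define R where "R N K = res_top N + res_mid N K + res_bot N K" for N K
  \<comment> \<open>Extension by zero past the truncation, with \<open>N = Suc p\<close>, turns the
    finite sums into series to which Tannery's theorem applies.\<close>
  define f where "f p K = (if p < K then R (Suc p) K * (1 / real (Suc p) ^ u) else 0)" for p K
  define b where "b p = (zeta2 - 1 / (2 * real (Suc p) ^ 2)) * (1 / real (Suc p) ^ u)" for p
  \<comment> \<open>The bound of \<open>abs_residue_le\<close> times \<open>N^-2\<close>, the worst
    case \<open>u = 2\<close>.\<close>
  define M where "M p = zeta2 * (1 / real (Suc p) ^ 2) + 12 * real (Suc p) powr (-3/2)" for p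
  have "summable (\<lambda>p. real (Suc p) powr (-3/2))"
    by (subst summable_Suc_iff[of "\<lambda>p. real p powr (-3/2)"], subst summable_real_powr_iff) simp
  hence M: "summable M"
    unfolding M_def by (intro summable_add summable_mult sums_summable[OF sums_zeta2])
  have lim: "f p \<longlonglongrightarrow> b p" for p
  proof (rule Lim_transform_eventually)
    have "(\<lambda>K. (res_top (Suc p) + res_mid (Suc p) K + res_bot (Suc p) K) * (1 / real (Suc p) ^ u))
        \<longlonglongrightarrow> (res_top (Suc p) + res_mid_lim (Suc p) + res_bot_lim (Suc p)) * (1 / real (Suc p) ^ u)"
      by (intro tendsto_intros tendsto_res_mid tendsto_res_bot) auto
    thus "(\<lambda>K. R (Suc p) K * (1 / real (Suc p) ^ u)) \<longlonglongrightarrow> b p"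
      unfolding R_def b_def by (subst (asm) residue_limit) auto
    show "eventually (\<lambda>K. R (Suc p) K * (1 / real (Suc p) ^ u) = f p K) sequentially"
      using eventually_gt_at_top[of p] by eventually_elim (simp add: f_def)
  qed
  have bound: "norm (f p K) \<le> M p" for p K
  proof (cases "p < K")
    case True
    define x where "x = real (Suc p)"
    have x: "x \<ge> 1" by (simp add: x_def)
    have "norm (f p K) = \<bar>R (Suc p) K\<bar> * (1 / x ^ u)"
      using True by (simp add: f_def abs_mult x_def)
    also have "\<dots> \<le> (zeta2 + 12 * sqrt x) * (1 / x ^ 2)"
    proof (rule mult_mono)
      show "\<bar>R (Suc p) K\<bar> \<le> zeta2 + 12 * sqrt x"
        unfolding R_def x_def using True by (intro abs_residue_le) auto
      thus "0 \<le> zeta2 + 12 * sqrt x" by linarith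
      show "1 / x ^ u \<le> 1 / x ^ 2" using x assms by (intro divide_left_mono power_increasing) auto
    qed (use x in auto)
    also have "\<dots> = zeta2 * (1 / x ^ 2) + 12 * (x powr (1/2) * x powr (-2))"
      using x by (simp add: algebra_simps powr_half_sqrt powr_minus_divide)
    also have "x powr (1/2) * x powr (-2) = x powr (-3/2)"
      unfolding powr_add[symmetric] by simp
    finally show ?thesis by (simp add: M_def x_def)
  next
    case False
    have "0 \<le> zeta2" using sums_le[OF _ sums_zero sums_zeta2] by simp
    thus ?thesis using False by (simp add: f_def M_def)
  qed
  have "(\<lambda>K. suminf (\<lambda>p. f p K)) \<longlonglongrightarrow> suminf b"
    using tannerys_theorem[of f b sequentially M, OF lim _ M] bound by (simp add: case_prod_unfold)
  also have "(\<lambda>K. suminf (\<lambda>p. f p K))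
      = (\<lambda>K. \<Sum>N=1..K. (res_top N + res_mid N K + res_bot N K) * (1 / real N ^ u))"
  proof
    fix K
    have "suminf (\<lambda>p. f p K) = (\<Sum>p<K. f p K)"
      by (rule suminf_finite) (auto simp: f_def)
    also have "\<dots> = (\<Sum>N=1..K. R N K * (1 / real N ^ u))"
      by (rule sum.reindex_bij_witness[of _ "\<lambda>N. N - 1" Suc]) (auto simp: f_def)
    finally show "suminf (\<lambda>p. f p K) = (\<Sum>N=1..K. (res_top N + res_mid N K + res_bot N K) * (1 / real N ^ u))"
      by (simp add: R_def)
  qed
  also have "suminf b = mzv [2] * mzv [u] - 1 / 2 * mzv [u + 2]"
  proof -
    have "(\<lambda>p. zeta2 * (1 / real (Suc p) ^ u) - 1 / 2 * (1 / real (Suc p) ^ (u + 2)))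
        sums (zeta2 * mzv [u] - 1 / 2 * mzv [u + 2])"
      using assms by (intro sums_diff sums_mult mzv_single_sums) auto
    also have "(\<lambda>p. zeta2 * (1 / real (Suc p) ^ u) - 1 / 2 * (1 / real (Suc p) ^ (u + 2))) = b"
      by (rule ext) (simp add: b_def power_add power2_eq_square diff_divide_distrib mult_ac)
    finally show ?thesis by (simp add: sums_iff mzv_2)
  qed
  finally show ?thesis .
qed

theorem theorem5p5:
  fixes w u :: nat
  assumes "w \<ge> 4" and "even w" and "u = w - 2"
  shows "(\<Sum>(a, b, c)\<in>{(a, b, c). a + b + c = w \<and> a \<ge> 2 \<and> b \<ge> 1 \<and> c \<ge> 1}.
            ((-1) ^ c - (-1) ^ a) * mzv [a, b, c])
         = 1 / 2 * mzv [w] - mzv [2] * mzv [u]"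
proof -
  \<comment> \<open>The degree left once the minimal exponents 2, 1, 1 are removed.\<close>
  define d where "d = w - 4"
  have d: "w = d + 4" "u = d + 2" "even d" using assms by (auto simp: d_def)
  define S :: "(nat \<times> nat \<times> nat) set" where
    "S = {(a, b, c). a + b + c = d + 4 \<and> a \<ge> 2 \<and> b \<ge> 1 \<and> c \<ge> 1}"
  have "(\<lambda>K. \<Sum>(a, b, c)\<in>S. ((-1) ^ c - (-1) ^ a) *
          (\<Sum>(k, m, n)\<in>triples_upto K. 1 / real k ^ a * (1 / real m ^ b * (1 / real n ^ c))))
        \<longlonglongrightarrow> (\<Sum>(a, b, c)\<in>S. ((-1) ^ c - (-1) ^ a) * mzv [a, b, c])"
    unfolding case_prod_unfold
    by (intro tendsto_sum tendsto_mult tendsto_const mzv_triple_tendsto[unfolded case_prod_unfold])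
       (auto simp: S_def)
  \<comment> \<open>Exchanging the sums over exponents and over index triples gives, for each
    triple, the signed sum treated by partial fractions.\<close>
  moreover have "(\<Sum>(a, b, c)\<in>S. ((-1) ^ c - (-1) ^ a) *
          (\<Sum>(k, m, n)\<in>triples_upto K. 1 / real k ^ a * (1 / real m ^ b * (1 / real n ^ c))))
        = - (\<Sum>N=1..K. (res_top N + res_mid N K + res_bot N K) * (1 / real N ^ u))" for K
    unfolding d(2) truncated_sum_eq_residues[OF d(3), folded S_def, symmetric]
    by (simp only: case_prod_unfold sum_distrib_left, rule sum.swap)
  ultimately have "(\<lambda>K. - (\<Sum>N=1..K. (res_top N + res_mid N K + res_bot N K) * (1 / real N ^ u)))
        \<longlonglongrightarrow> (\<Sum>(a, b, c)\<in>S. ((-1) ^ c - (-1) ^ a) * mzv [a, b, c])"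
    by simp
  moreover have "(\<lambda>K. - (\<Sum>N=1..K. (res_top N + res_mid N K + res_bot N K) * (1 / real N ^ u)))
        \<longlonglongrightarrow> - (mzv [2] * mzv [u] - 1 / 2 * mzv [u + 2])"
    by (intro tendsto_minus tendsto_sum_residues) (simp add: d)
  ultimately have "(\<Sum>(a, b, c)\<in>S. ((-1) ^ c - (-1) ^ a) * mzv [a, b, c])
      = - (mzv [2] * mzv [u] - 1 / 2 * mzv [u + 2])"
    by (rule LIMSEQ_unique)
  moreover have "u + 2 = w" by (simp add: d)
  ultimately show ?thesis unfolding S_def d(1)[symmetric] by simp
qed

end
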